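(* Let $G$ and $H$ be finite, simple, connected graphs, each with at least one edge, with $\zeta(G)>0$ and $\zeta(H)>0$. Then $G$ and $H$ are both stable in respect of chromatic completion ($SCC$) if and only if the join $G+H$ is stable in respect of chromatic completion ($SCC$).
   Context: A chromatic colouring of a graph $G$ is a proper vertex colouring $\varphi$ of $G$ with exactly $\chi(G)$ colours. For a chromatic colouring $\varphi$, let $E_\varphi(G)$ be the set of all pairs $uv$ of distinct non-adjacent vertices of $G$ with $\varphi(u)\neq\varphi(v)$. The chromatic completion number is $\zeta(G)=\max_\varphi |E_\varphi(G)|$, the maximum taken over all chromatic colourings $\varphi$ of $G$. A Lucky colouring of $G$ is a chromatic colouring $\varphi$ whose colour classes yield the maximum number of chromatic completion edges, i.e. $|E_\varphi(G)|=\zeta(G)$. (In particular, if $G$ has a chromatic colouring whose colour-class sizes pairwise differ by at most $1$, the Lucky colourings are exactly those chromatic colourings.) The graph $G$ is stable in respect of chromatic completion ($SCC$) if all Lucky colourings of $G$ yield the same partition of $V(G)$ into colour classes (so they differ only by interchanging colours). The join $G+H$ is obtained from the disjoint union of $G$ and $H$ by adding all edges $uv$ with $u\in V(G)$, $v\in V(H)$. *)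

theory Defs
  imports "Graph_Theory.Pair_Digraph" "Graph_Theory.Digraph_Component"
begin

text \<open>
  A finite simple graph is a \<open>pair_graph\<close>: an edge \<open>uv\<close> is represented by the two
  arcs \<open>(u, v)\<close> and \<open>(v, u)\<close>. Colours are natural numbers; a colouring is a total
  function, of which only the values on the vertices matter.
\<close>

definition proper_colouring :: "'a pair_pre_digraph \<Rightarrow> ('a \<Rightarrow> nat) \<Rightarrow> bool" where
  "proper_colouring G \<phi> \<longleftrightarrow> (\<forall>(u, v) \<in> parcs G. \<phi> u \<noteq> \<phi> v)"

definition chromatic_number :: "'a pair_pre_digraph \<Rightarrow> nat" where
  "chromatic_number G = (LEAST k. \<exists>\<phi>. proper_colouring G \<phi> \<and> card (\<phi> ` pverts G) = k)"

definition chromatic_colouring :: "'a pair_pre_digraph \<Rightarrow> ('a \<Rightarrow> nat) \<Rightarrow> bool" where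
  "chromatic_colouring G \<phi> \<longleftrightarrow>
     proper_colouring G \<phi> \<and> card (\<phi> ` pverts G) = chromatic_number G"

definition completion_edges :: "'a pair_pre_digraph \<Rightarrow> ('a \<Rightarrow> nat) \<Rightarrow> 'a set set" where
  "completion_edges G \<phi> =
     {{u, v} | u v. u \<in> pverts G \<and> v \<in> pverts G \<and> u \<noteq> v \<and> (u, v) \<notin> parcs G \<and> \<phi> u \<noteq> \<phi> v}"

definition chromatic_completion_number :: "'a pair_pre_digraph \<Rightarrow> nat" where
  "chromatic_completion_number G =
     Max {card (completion_edges G \<phi>) | \<phi>. chromatic_colouring G \<phi>}"

definition lucky_colouring :: "'a pair_pre_digraph \<Rightarrow> ('a \<Rightarrow> nat) \<Rightarrow> bool" where
  "lucky_colouring G \<phi> \<longleftrightarrow>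
     chromatic_colouring G \<phi> \<and> card (completion_edges G \<phi>) = chromatic_completion_number G"

definition colour_classes :: "'a pair_pre_digraph \<Rightarrow> ('a \<Rightarrow> nat) \<Rightarrow> 'a set set" where
  "colour_classes G \<phi> = (\<lambda>c. {v \<in> pverts G. \<phi> v = c}) ` \<phi> ` pverts G"

definition SCC :: "'a pair_pre_digraph \<Rightarrow> bool" where
  "SCC G \<longleftrightarrow>
     (\<forall>\<phi> \<psi>. lucky_colouring G \<phi> \<longrightarrow> lucky_colouring G \<psi> \<longrightarrow>
        colour_classes G \<phi> = colour_classes G \<psi>)"

definition graph_join ::
  "'a pair_pre_digraph \<Rightarrow> 'b pair_pre_digraph \<Rightarrow> ('a + 'b) pair_pre_digraph" where
  "graph_join G H =
     \<lparr> pverts = pverts G <+> pverts H,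
       parcs = map_prod Inl Inl ` parcs G \<union> map_prod Inr Inr ` parcs H
             \<union> (Inl ` pverts G) \<times> (Inr ` pverts H) \<union> (Inr ` pverts H) \<times> (Inl ` pverts G) \<rparr>"

lemma pair_graph_graph_join:
  assumes "pair_graph G" "pair_graph H"
  shows "pair_graph (graph_join G H)"
proof -
  interpret G: pair_graph G by fact
  interpret H: pair_graph H by fact
  have sG: "(v, u) \<in> parcs G" if "(u, v) \<in> parcs G" for u v
    using that G.pair_sym_arcs by (auto simp: symmetric_def dest: symD)
  have sH: "(v, u) \<in> parcs H" if "(u, v) \<in> parcs H" for u v
    using that H.pair_sym_arcs by (auto simp: symmetric_def dest: symD)
  have "symmetric (with_proj (graph_join G H))"
    unfolding symmetric_def with_proj_simps
  proof (rule symI)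
    fix x y assume "(x, y) \<in> parcs (graph_join G H)"
    then show "(y, x) \<in> parcs (graph_join G H)"
      by (cases x; cases y) (auto simp: graph_join_def map_prod_def image_iff split_beta
          intro: bexI[OF _ sG] bexI[OF _ sH])
  qed
  moreover have "finite (pverts (graph_join G H))" "finite (parcs (graph_join G H))"
    by (simp_all add: graph_join_def G.pair_finite_verts H.pair_finite_verts
        G.pair_finite_arcs H.pair_finite_arcs)
  moreover have "fst e \<in> pverts (graph_join G H) \<and> snd e \<in> pverts (graph_join G H) \<and> fst e \<noteq> snd e"
    if "e \<in> parcs (graph_join G H)" for e
    using that G.pair_no_loops H.pair_no_loops
    unfolding graph_join_def by (auto dest: G.wellformed' H.wellformed')
  ultimately show ?thesis by unfold_locales auto
qed

lemma ex_chromatic_colouring: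
  assumes "pair_graph G"
  shows "\<exists>\<phi>. chromatic_colouring G \<phi>"
proof -
  interpret pair_graph G by fact
  obtain \<phi> :: "'a \<Rightarrow> nat" where "inj_on \<phi> (pverts G)"
    using finite_imp_inj_to_nat_seg[OF pair_finite_verts] by blast
  then have "proper_colouring G \<phi>"
    using pair_no_loops unfolding proper_colouring_def
    by (auto dest!: inj_onD dest: wellformed') blast
  then have "\<exists>\<psi>. proper_colouring G \<psi> \<and> card (\<psi> ` pverts G) = card (\<phi> ` pverts G)"
    by blast
  then show ?thesis
    unfolding chromatic_colouring_def chromatic_number_def by (rule LeastI)
qed

text \<open>The maximum defining the chromatic completion number is taken over a finite nonempty set.\<close>

lemma ex_lucky_colouring:
  assumes "pair_graph G"
  shows "\<exists>\<phi>. lucky_colouring G \<phi>"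
proof -
  interpret pair_graph G by fact
  let ?S = "{card (completion_edges G \<phi>) | \<phi>. chromatic_colouring G \<phi>}"
  have "card (completion_edges G \<phi>) \<le> card (Pow (pverts G))" for \<phi>
    by (rule card_mono) (auto simp: completion_edges_def pair_finite_verts)
  then have "finite ?S" by (auto intro: finite_subset[of _ "{..card (Pow (pverts G))}"])
  moreover have "?S \<noteq> {}" using ex_chromatic_colouring[OF assms] by auto
  ultimately have "Max ?S \<in> ?S" by (rule Max_in)
  then show ?thesis
    unfolding lucky_colouring_def chromatic_completion_number_def by auto
qed

end

theory Submission
  imports Defs
begin

text \<open>
  Every vertex of \<open>G\<close> is adjacent in the join to every vertex of \<open>H\<close>. Two things follow for a
  proper colouring of the join: the two sides share no colour, so colour counts and colour
  classes split into a \<open>G\<close>-part and an \<open>H\<close>-part; and no completion edge runs between the sides, so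
  the completion edges split as well. Conversely any two colourings of the sides can be combined
  once their palettes have been made disjoint, which changes neither colour classes nor completion
  edges. Hence both the chromatic number and the chromatic completion number are additive, and
  a colouring of the join is Lucky exactly when its two restrictions are Lucky and use disjoint
  palettes (lemma \<open>lucky_colouring_graph_join\<close>).

  Its colour classes are then the colour classes of the two restrictions, and they determine
  these in turn, because a nonempty class lies on one side only
  (\<open>colour_classes_graph_join_eq_iff\<close>). So the Lucky partitions of the join correspond to the
  pairs of Lucky partitions of \<open>G\<close> and \<open>H\<close>. Both graphs have a Lucky partition, so there is only
  one such pair if and only if each graph has only one.
\<close>

section \<open>Optimality and change of palette\<close>

lemma chromatic_number_le:
  "proper_colouring G \<phi> \<Longrightarrow> chromatic_number G \<le> card (\<phi> ` pverts G)"
  unfolding chromatic_number_def by (rule Least_le) blast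

lemma card_completion_edges_le:
  assumes "pair_graph G" and "chromatic_colouring G \<phi>"
  shows "card (completion_edges G \<phi>) \<le> chromatic_completion_number G"
proof -
  interpret pair_graph G by fact
  have "card (completion_edges G \<psi>) \<le> card (Pow (pverts G))" for \<psi>
    by (rule card_mono) (auto simp: completion_edges_def pair_finite_verts)
  then have "finite {card (completion_edges G \<psi>) | \<psi>. chromatic_colouring G \<psi>}"
    by (auto intro: finite_subset[of _ "{..card (Pow (pverts G))}"])
  then show ?thesis
    using assms(2) unfolding chromatic_completion_number_def by (intro Max_ge) auto
qed

lemma proper_colouring_recolour:
  "inj f \<Longrightarrow> proper_colouring G (f \<circ> \<phi>) \<longleftrightarrow> proper_colouring G \<phi>"
  unfolding proper_colouring_def by (simp add: inj_eq)

lemma completion_edges_recolour: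
  "inj f \<Longrightarrow> completion_edges G (f \<circ> \<phi>) = completion_edges G \<phi>"
  unfolding completion_edges_def by (simp add: inj_eq)

lemma card_colours_recolour:
  "inj f \<Longrightarrow> card ((f \<circ> \<phi>) ` pverts G) = card (\<phi> ` pverts G)"
  by (simp only: image_comp[symmetric]) (blast intro: card_image inj_on_subset)

lemma chromatic_colouring_recolour:
  "inj f \<Longrightarrow> chromatic_colouring G (f \<circ> \<phi>) \<longleftrightarrow> chromatic_colouring G \<phi>"
  unfolding chromatic_colouring_def
  by (simp only: proper_colouring_recolour card_colours_recolour)

lemma lucky_colouring_recolour:
  "inj f \<Longrightarrow> lucky_colouring G (f \<circ> \<phi>) \<longleftrightarrow> lucky_colouring G \<phi>"
  unfolding lucky_colouring_def
  by (simp only: chromatic_colouring_recolour completion_edges_recolour)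

lemma colour_classes_eq_image:
  "colour_classes G \<phi> = (\<lambda>w. {v \<in> pverts G. \<phi> v = \<phi> w}) ` pverts G"
  unfolding colour_classes_def by (simp add: image_image)

lemma colour_classes_recolour:
  "inj f \<Longrightarrow> colour_classes G (f \<circ> \<phi>) = colour_classes G \<phi>"
  unfolding colour_classes_eq_image by (simp add: inj_eq)

section \<open>Colourings of the join\<close>

text \<open>Colours from \<open>G\<close> are made even and those from \<open>H\<close> odd, so that the palettes are disjoint.\<close>

definition join_colouring :: "('a \<Rightarrow> nat) \<Rightarrow> ('b \<Rightarrow> nat) \<Rightarrow> 'a + 'b \<Rightarrow> nat" where
  "join_colouring \<phi> \<psi> = case_sum ((\<lambda>c. 2 * c) \<circ> \<phi>) ((\<lambda>c. 2 * c + 1) \<circ> \<psi>)"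

lemma join_colouring_comp_Inl: "join_colouring \<phi> \<psi> \<circ> Inl = (\<lambda>c. 2 * c) \<circ> \<phi>"
  and join_colouring_comp_Inr: "join_colouring \<phi> \<psi> \<circ> Inr = (\<lambda>c. 2 * c + 1) \<circ> \<psi>"
  by (auto simp: join_colouring_def)

lemma inj_even: "inj (\<lambda>c::nat. 2 * c)" and inj_odd: "inj (\<lambda>c::nat. 2 * c + 1)"
  by (auto simp: inj_def)

definition disjoint_palettes ::
  "'a pair_pre_digraph \<Rightarrow> 'b pair_pre_digraph \<Rightarrow> ('a + 'b \<Rightarrow> nat) \<Rightarrow> bool" where
  "disjoint_palettes G H \<theta> \<longleftrightarrow> (\<theta> \<circ> Inl) ` pverts G \<inter> (\<theta> \<circ> Inr) ` pverts H = {}"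

lemma disjoint_palettes_iff:
  "disjoint_palettes G H \<theta> \<longleftrightarrow> (\<forall>u \<in> pverts G. \<forall>v \<in> pverts H. \<theta> (Inl u) \<noteq> \<theta> (Inr v))"
  unfolding disjoint_palettes_def by fastforce

lemma disjoint_palettes_join_colouring: "disjoint_palettes G H (join_colouring \<phi> \<psi>)"
  unfolding disjoint_palettes_iff join_colouring_def using double_not_eq_Suc_double by simp

lemma pverts_graph_join: "pverts (graph_join G H) = Inl ` pverts G \<union> Inr ` pverts H"
  by (auto simp: graph_join_def)

lemma parcs_graph_join_simps:
  "(Inl u, Inl u') \<in> parcs (graph_join G H) \<longleftrightarrow> (u, u') \<in> parcs G"
  "(Inr v, Inr v') \<in> parcs (graph_join G H) \<longleftrightarrow> (v, v') \<in> parcs H"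
  "(Inl u, Inr v) \<in> parcs (graph_join G H) \<longleftrightarrow> u \<in> pverts G \<and> v \<in> pverts H"
  "(Inr v, Inl u) \<in> parcs (graph_join G H) \<longleftrightarrow> u \<in> pverts G \<and> v \<in> pverts H"
  by (auto simp: graph_join_def map_prod_def image_iff split_beta intro: rev_bexI)

lemma proper_colouring_graph_join:
  "proper_colouring (graph_join G H) \<theta> \<longleftrightarrow>
     proper_colouring G (\<theta> \<circ> Inl) \<and> proper_colouring H (\<theta> \<circ> Inr) \<and> disjoint_palettes G H \<theta>"
proof
  assume *: "proper_colouring (graph_join G H) \<theta>"
  have "\<theta> x \<noteq> \<theta> y" if "(x, y) \<in> parcs (graph_join G H)" for x y
    using * that unfolding proper_colouring_def by blast
  then show "proper_colouring G (\<theta> \<circ> Inl) \<and> proper_colouring H (\<theta> \<circ> Inr) \<and> disjoint_palettes G H \<theta>"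
    unfolding proper_colouring_def disjoint_palettes_iff
    by (auto simp: parcs_graph_join_simps)
next
  assume *: "proper_colouring G (\<theta> \<circ> Inl) \<and> proper_colouring H (\<theta> \<circ> Inr) \<and> disjoint_palettes G H \<theta>"
  have "\<theta> x \<noteq> \<theta> y" if "(x, y) \<in> parcs (graph_join G H)" for x y
    using * that unfolding proper_colouring_def disjoint_palettes_iff
    by (cases x; cases y) (fastforce simp: parcs_graph_join_simps)+
  then show "proper_colouring (graph_join G H) \<theta>"
    unfolding proper_colouring_def by blast
qed

lemma card_colours_graph_join:
  assumes "pair_graph G" and "pair_graph H" and "disjoint_palettes G H \<theta>"
  shows "card (\<theta> ` pverts (graph_join G H)) =
           card ((\<theta> \<circ> Inl) ` pverts G) + card ((\<theta> \<circ> Inr) ` pverts H)"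
proof -
  interpret G: pair_graph G by fact
  interpret H: pair_graph H by fact
  have "\<theta> ` pverts (graph_join G H) = (\<theta> \<circ> Inl) ` pverts G \<union> (\<theta> \<circ> Inr) ` pverts H"
    by (simp add: pverts_graph_join image_Un image_comp)
  then show ?thesis
    using assms(3) unfolding disjoint_palettes_def
    by (simp add: card_Un_disjoint G.pair_finite_verts H.pair_finite_verts)
qed

text \<open>
  Disjointness of palettes gives superadditivity of the chromatic number, and combining chromatic
  colourings of the two sides shows that the bound is attained.
\<close>

lemma chromatic_number_graph_join:
  assumes "pair_graph G" and "pair_graph H"
  shows "chromatic_number (graph_join G H) = chromatic_number G + chromatic_number H"
proof (rule antisym)
  obtain \<phi> \<psi> where "chromatic_colouring G \<phi>" "chromatic_colouring H \<psi>"
    using ex_chromatic_colouring[OF assms(1)] ex_chromatic_colouring[OF assms(2)] by blast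
  then have *: "chromatic_colouring G (join_colouring \<phi> \<psi> \<circ> Inl)"
      "chromatic_colouring H (join_colouring \<phi> \<psi> \<circ> Inr)"
    unfolding join_colouring_comp_Inl join_colouring_comp_Inr
    by (simp_all only: chromatic_colouring_recolour inj_even inj_odd)
  then have "proper_colouring (graph_join G H) (join_colouring \<phi> \<psi>)"
    unfolding proper_colouring_graph_join chromatic_colouring_def
    by (simp add: disjoint_palettes_join_colouring)
  from chromatic_number_le[OF this] *
  show "chromatic_number (graph_join G H) \<le> chromatic_number G + chromatic_number H"
    unfolding chromatic_colouring_def
    by (simp only: card_colours_graph_join[OF assms disjoint_palettes_join_colouring])
next
  obtain \<theta> where "chromatic_colouring (graph_join G H) \<theta>"
    using ex_chromatic_colouring[OF pair_graph_graph_join[OF assms]] by blast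
  then have "proper_colouring G (\<theta> \<circ> Inl)" "proper_colouring H (\<theta> \<circ> Inr)"
      "disjoint_palettes G H \<theta>"
      "chromatic_number (graph_join G H) = card (\<theta> ` pverts (graph_join G H))"
    unfolding chromatic_colouring_def proper_colouring_graph_join by simp_all
  then show "chromatic_number G + chromatic_number H \<le> chromatic_number (graph_join G H)"
    by (simp only: card_colours_graph_join[OF assms] chromatic_number_le add_mono)
qed

lemma chromatic_colouring_graph_join:
  assumes "pair_graph G" and "pair_graph H"
  shows "chromatic_colouring (graph_join G H) \<theta> \<longleftrightarrow>
     chromatic_colouring G (\<theta> \<circ> Inl) \<and> chromatic_colouring H (\<theta> \<circ> Inr) \<and> disjoint_palettes G H \<theta>"
proof -
  \<comment> \<open>Neither summand can be below its minimum, so a minimal sum forces both to be minimal.\<close>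
  have "card ((\<theta> \<circ> Inl) ` pverts G) + card ((\<theta> \<circ> Inr) ` pverts H)
          = chromatic_number G + chromatic_number H \<longleftrightarrow>
        card ((\<theta> \<circ> Inl) ` pverts G) = chromatic_number G \<and>
        card ((\<theta> \<circ> Inr) ` pverts H) = chromatic_number H"
    if "proper_colouring G (\<theta> \<circ> Inl)" "proper_colouring H (\<theta> \<circ> Inr)"
    using chromatic_number_le[OF that(1)] chromatic_number_le[OF that(2)] by linarith
  then show ?thesis
    unfolding chromatic_colouring_def proper_colouring_graph_join
      chromatic_number_graph_join[OF assms]
    using card_colours_graph_join[OF assms, of \<theta>] by metis
qed

section \<open>Completion edges and Lucky colourings of the join\<close>

lemma completion_edges_graph_join:
  "completion_edges (graph_join G H) \<theta> =
     (`) Inl ` completion_edges G (\<theta> \<circ> Inl) \<union> (`) Inr ` completion_edges H (\<theta> \<circ> Inr)"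
  (is "?J = ?L \<union> ?R")
proof
  show "?J \<subseteq> ?L \<union> ?R"
  proof
    fix e assume "e \<in> ?J"
    then obtain x y where e: "e = {x, y}" "x \<in> pverts (graph_join G H)"
        "y \<in> pverts (graph_join G H)" "x \<noteq> y" "(x, y) \<notin> parcs (graph_join G H)" "\<theta> x \<noteq> \<theta> y"
      unfolding completion_edges_def by blast
    \<comment> \<open>The mixed cases are void: vertices on different sides are adjacent.\<close>
    then consider (l) u u' where "x = Inl u" "y = Inl u'" | (r) v v' where "x = Inr v" "y = Inr v'"
      by (cases x; cases y) (auto simp: pverts_graph_join parcs_graph_join_simps)
    then show "e \<in> ?L \<union> ?R"
    proof cases
      case l
      with e have "{u, u'} \<in> completion_edges G (\<theta> \<circ> Inl)"
        unfolding completion_edges_def by (auto simp: pverts_graph_join parcs_graph_join_simps)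
      then have "Inl ` {u, u'} \<in> ?L" by (rule imageI)
      with e l show ?thesis by simp
    next
      case r
      with e have "{v, v'} \<in> completion_edges H (\<theta> \<circ> Inr)"
        unfolding completion_edges_def by (auto simp: pverts_graph_join parcs_graph_join_simps)
      then have "Inr ` {v, v'} \<in> ?R" by (rule imageI)
      with e r show ?thesis by simp
    qed
  qed
  have edge: "{x, y} \<in> ?J" if "x \<in> pverts (graph_join G H)" "y \<in> pverts (graph_join G H)"
      "x \<noteq> y" "(x, y) \<notin> parcs (graph_join G H)" "\<theta> x \<noteq> \<theta> y" for x y
    using that unfolding completion_edges_def by blast
  have "?L \<subseteq> ?J" "?R \<subseteq> ?J"
    unfolding completion_edges_def[of G] completion_edges_def[of H]
    by (auto simp: pverts_graph_join parcs_graph_join_simps intro!: edge)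
  then show "?L \<union> ?R \<subseteq> ?J" by simp
qed

lemma inj_image_Inl: "inj ((`) Inl)" and inj_image_Inr: "inj ((`) Inr)"
  by (auto simp: inj_def inj_image_eq_iff)

lemma card_completion_edges_graph_join:
  assumes "pair_graph G" and "pair_graph H"
  shows "card (completion_edges (graph_join G H) \<theta>) =
           card (completion_edges G (\<theta> \<circ> Inl)) + card (completion_edges H (\<theta> \<circ> Inr))"
proof -
  interpret G: pair_graph G by fact
  interpret H: pair_graph H by fact
  have "finite (completion_edges G (\<theta> \<circ> Inl))" "finite (completion_edges H (\<theta> \<circ> Inr))"
    by (rule finite_subset[of _ "Pow (pverts _)"],
        auto simp: completion_edges_def G.pair_finite_verts H.pair_finite_verts)+
  moreover have "(`) Inl ` completion_edges G (\<theta> \<circ> Inl) \<inter>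
                 (`) Inr ` completion_edges H (\<theta> \<circ> Inr) = {}"
    unfolding completion_edges_def by auto
  ultimately show ?thesis
    unfolding completion_edges_graph_join
    by (simp add: card_Un_disjoint card_image inj_on_subset[OF inj_image_Inl]
        inj_on_subset[OF inj_image_Inr])
qed

lemma chromatic_completion_number_graph_join:
  assumes "pair_graph G" and "pair_graph H"
  shows "chromatic_completion_number (graph_join G H) =
           chromatic_completion_number G + chromatic_completion_number H"
proof (rule antisym)
  obtain \<theta> where "lucky_colouring (graph_join G H) \<theta>"
    using ex_lucky_colouring[OF pair_graph_graph_join[OF assms]] by blast
  then have "chromatic_colouring G (\<theta> \<circ> Inl)" "chromatic_colouring H (\<theta> \<circ> Inr)"
      "chromatic_completion_number (graph_join G H) = card (completion_edges (graph_join G H) \<theta>)"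
    unfolding lucky_colouring_def chromatic_colouring_graph_join[OF assms] by simp_all
  then show "chromatic_completion_number (graph_join G H) \<le>
      chromatic_completion_number G + chromatic_completion_number H"
    by (simp add: card_completion_edges_graph_join assms card_completion_edges_le add_mono)
next
  obtain \<phi> \<psi> where lucky: "lucky_colouring G \<phi>" "lucky_colouring H \<psi>"
    using ex_lucky_colouring[OF assms(1)] ex_lucky_colouring[OF assms(2)] by blast
  let ?\<theta> = "join_colouring \<phi> \<psi>"
  have *: "lucky_colouring G (?\<theta> \<circ> Inl)" "lucky_colouring H (?\<theta> \<circ> Inr)"
    unfolding join_colouring_comp_Inl join_colouring_comp_Inr
    using lucky by (simp_all only: lucky_colouring_recolour inj_even inj_odd)
  then have "chromatic_colouring (graph_join G H) ?\<theta>"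
    unfolding chromatic_colouring_graph_join[OF assms] lucky_colouring_def
    by (simp add: disjoint_palettes_join_colouring)
  from card_completion_edges_le[OF pair_graph_graph_join[OF assms] this] *
  show "chromatic_completion_number G + chromatic_completion_number H \<le>
      chromatic_completion_number (graph_join G H)"
    unfolding lucky_colouring_def by (simp only: card_completion_edges_graph_join[OF assms])
qed

lemma lucky_colouring_graph_join:
  assumes "pair_graph G" and "pair_graph H"
  shows "lucky_colouring (graph_join G H) \<theta> \<longleftrightarrow>
     lucky_colouring G (\<theta> \<circ> Inl) \<and> lucky_colouring H (\<theta> \<circ> Inr) \<and> disjoint_palettes G H \<theta>"
proof -
  \<comment> \<open>Neither summand can exceed its maximum, so a maximal sum forces both to be maximal.\<close>
  have "card (completion_edges G (\<theta> \<circ> Inl)) + card (completion_edges H (\<theta> \<circ> Inr))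
          = chromatic_completion_number G + chromatic_completion_number H \<longleftrightarrow>
        card (completion_edges G (\<theta> \<circ> Inl)) = chromatic_completion_number G \<and>
        card (completion_edges H (\<theta> \<circ> Inr)) = chromatic_completion_number H"
    if "chromatic_colouring G (\<theta> \<circ> Inl)" "chromatic_colouring H (\<theta> \<circ> Inr)"
    using card_completion_edges_le[OF assms(1) that(1)]
      card_completion_edges_le[OF assms(2) that(2)] by linarith
  then show ?thesis
    unfolding lucky_colouring_def chromatic_colouring_graph_join[OF assms]
      chromatic_completion_number_graph_join[OF assms] card_completion_edges_graph_join[OF assms]
    by blast
qed

lemma lucky_join_colouring:
  assumes "pair_graph G" and "pair_graph H" and "lucky_colouring G \<phi>" and "lucky_colouring H \<psi>"
  shows "lucky_colouring (graph_join G H) (join_colouring \<phi> \<psi>)"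
  unfolding lucky_colouring_graph_join[OF assms(1,2)] join_colouring_comp_Inl
    join_colouring_comp_Inr
  using assms(3,4)
  by (simp only: lucky_colouring_recolour inj_even inj_odd disjoint_palettes_join_colouring)

section \<open>Colour classes of the join\<close>

lemma colour_classes_graph_join:
  assumes "disjoint_palettes G H \<theta>"
  shows "colour_classes (graph_join G H) \<theta> =
     (`) Inl ` colour_classes G (\<theta> \<circ> Inl) \<union> (`) Inr ` colour_classes H (\<theta> \<circ> Inr)"
proof -
  have ne: "\<theta> (Inl u) \<noteq> \<theta> (Inr v)" if "u \<in> pverts G" "v \<in> pverts H" for u v
    using assms that unfolding disjoint_palettes_iff by blast
  have "{x \<in> pverts (graph_join G H). \<theta> x = \<theta> (Inl w)} =
        Inl ` {u \<in> pverts G. (\<theta> \<circ> Inl) u = (\<theta> \<circ> Inl) w}" if "w \<in> pverts G" for w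
    using ne[OF that] by (auto simp: pverts_graph_join dest: sym)
  moreover have "{x \<in> pverts (graph_join G H). \<theta> x = \<theta> (Inr w)} =
        Inr ` {v \<in> pverts H. (\<theta> \<circ> Inr) v = (\<theta> \<circ> Inr) w}" if "w \<in> pverts H" for w
    using ne[OF _ that] by (auto simp: pverts_graph_join)
  ultimately show ?thesis
    unfolding colour_classes_eq_image
    by (simp add: pverts_graph_join[of G H] image_Un image_image cong: image_cong_simp)
qed

text \<open>
  The empty set is the only set that is both an \<open>Inl\<close>-image and an \<open>Inr\<close>-image; excluding it, a
  family of one-sided sets can be split back into its two parts.
\<close>

lemma image_Inl_Un_image_Inr_eqD:
  assumes "(`) Inl ` A \<union> (`) Inr ` B = (`) Inl ` A' \<union> (`) Inr ` B'"
    and "{} \<notin> A" and "{} \<notin> A'" and "{} \<notin> B" and "{} \<notin> B'"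
  shows "A = A' \<and> B = B'"
proof -
  have Inl_mem: "Inl ` X \<in> (`) Inl ` C \<union> (`) Inr ` D \<longleftrightarrow> X \<in> C" if "X \<noteq> {}"
    for X :: "'a set" and C and D :: "'b set set"
    using that by (auto simp: inj_image_mem_iff[OF inj_image_Inl])
  have Inr_mem: "Inr ` Y \<in> (`) Inl ` C \<union> (`) Inr ` D \<longleftrightarrow> Y \<in> D" if "Y \<noteq> {}"
    for Y :: "'b set" and C :: "'a set set" and D
    using that by (auto simp: inj_image_mem_iff[OF inj_image_Inr])
  have "X \<in> A \<longleftrightarrow> X \<in> A'" for X
    using assms Inl_mem[of X A B] Inl_mem[of X A' B'] by (cases "X = {}") auto
  moreover have "Y \<in> B \<longleftrightarrow> Y \<in> B'" for Y
    using assms Inr_mem[of Y A B] Inr_mem[of Y A' B'] by (cases "Y = {}") auto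
  ultimately show ?thesis by blast
qed

lemma empty_notin_colour_classes: "{} \<notin> colour_classes G \<phi>"
  unfolding colour_classes_eq_image by auto

lemma colour_classes_graph_join_eq_iff:
  assumes "disjoint_palettes G H \<theta>" and "disjoint_palettes G H \<theta>'"
  shows "colour_classes (graph_join G H) \<theta> = colour_classes (graph_join G H) \<theta>' \<longleftrightarrow>
     colour_classes G (\<theta> \<circ> Inl) = colour_classes G (\<theta>' \<circ> Inl) \<and>
     colour_classes H (\<theta> \<circ> Inr) = colour_classes H (\<theta>' \<circ> Inr)"
  unfolding colour_classes_graph_join[OF assms(1)] colour_classes_graph_join[OF assms(2)]
  using image_Inl_Un_image_Inr_eqD[OF _ empty_notin_colour_classes empty_notin_colour_classes
      empty_notin_colour_classes empty_notin_colour_classes]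
  by metis

lemma colour_classes_join_colouring_eq_iff:
  "colour_classes (graph_join G H) (join_colouring \<phi> \<psi>) =
     colour_classes (graph_join G H) (join_colouring \<phi>' \<psi>') \<longleftrightarrow>
   colour_classes G \<phi> = colour_classes G \<phi>' \<and> colour_classes H \<psi> = colour_classes H \<psi>'"
  unfolding colour_classes_graph_join_eq_iff[OF disjoint_palettes_join_colouring
      disjoint_palettes_join_colouring] join_colouring_comp_Inl join_colouring_comp_Inr
  by (simp only: colour_classes_recolour inj_even inj_odd)

section \<open>Stability of the join\<close>

theorem corollary4p3:
  fixes G :: "'a pair_pre_digraph" and H :: "'b pair_pre_digraph"
  assumes "pair_graph G" and "pair_graph H"
    and "Digraph_Component.connected (with_proj G)" and "Digraph_Component.connected (with_proj H)"
    and "parcs G \<noteq> {}" and "parcs H \<noteq> {}"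
    and "chromatic_completion_number G > 0" and "chromatic_completion_number H > 0"
  shows "SCC G \<and> SCC H \<longleftrightarrow> SCC (graph_join G H)"
proof
  assume "SCC G \<and> SCC H"
  then show "SCC (graph_join G H)"
    unfolding SCC_def lucky_colouring_graph_join[OF assms(1,2)]
    using colour_classes_graph_join_eq_iff by metis
next
  assume J: "SCC (graph_join G H)"
  have unique: "colour_classes G \<phi> = colour_classes G \<phi>' \<and> colour_classes H \<psi> = colour_classes H \<psi>'"
    if "lucky_colouring G \<phi>" "lucky_colouring G \<phi>'" "lucky_colouring H \<psi>" "lucky_colouring H \<psi>'"
    for \<phi> \<phi>' \<psi> \<psi>'
    using J lucky_join_colouring[OF assms(1,2) that(1,3)] lucky_join_colouring[OF assms(1,2) that(2,4)]
    unfolding SCC_def colour_classes_join_colouring_eq_iff[symmetric] by blast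
  \<comment> \<open>To compare two colourings of one side, some Lucky colouring of the other side is needed.\<close>
  obtain \<phi>\<^sub>0 \<psi>\<^sub>0 where "lucky_colouring G \<phi>\<^sub>0" "lucky_colouring H \<psi>\<^sub>0"
    using ex_lucky_colouring[OF assms(1)] ex_lucky_colouring[OF assms(2)] by blast
  with unique show "SCC G \<and> SCC H"
    unfolding SCC_def by blast
qed

end
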